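(* If $T\in\mathbb{B}(\mathcal{H})$ is paranormal and $T^n$ is quasinormal for some $n\in\mathbb{N}$, then $T$ is quasinormal.
   Context: $\mathbb{N}$ denotes the positive integers. $\mathbb{B}(\mathcal{H})$ is the algebra of bounded linear operators on a complex Hilbert space $\mathcal{H}$. An operator $T$ is quasinormal if $T(T^*T)=(T^*T)T$, and paranormal if $\|Tx\|^2\le\|T^2x\|\,\|x\|$ for all $x\in\mathcal{H}$. *)

theory Defs
  imports "HOL-Analysis.Analysis"
begin

class complex_vector = real_vector +
  fixes scaleC :: "complex \<Rightarrow> 'a \<Rightarrow> 'a" (infixr \<open>*\<^sub>C\<close> 75)
  assumes scaleC_add_right: "a *\<^sub>C (x + y) = a *\<^sub>C x + a *\<^sub>C y"
    and scaleC_add_left: "(a + b) *\<^sub>C x = a *\<^sub>C x + b *\<^sub>C x"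
    and scaleC_scaleC: "a *\<^sub>C (b *\<^sub>C x) = (a * b) *\<^sub>C x"
    and scaleC_of_real: "complex_of_real r *\<^sub>C x = r *\<^sub>R x"

(* The inner product is linear in the first argument. Positive definiteness
   follows from cinner_self and the norm axioms of real_normed_vector. *)
class complex_inner = complex_vector + real_normed_vector +
  fixes cinner :: "'a \<Rightarrow> 'a \<Rightarrow> complex"
  assumes cinner_commute: "cinner x y = cnj (cinner y x)"
    and cinner_add_left: "cinner (x + y) z = cinner x z + cinner y z"
    and cinner_scaleC_left: "cinner (a *\<^sub>C x) y = a * cinner x y"
    and cinner_self: "cinner x x = complex_of_real ((norm x)\<^sup>2)"

class complex_hilbert_space = complex_inner + complete_space

instantiation complex :: complex_hilbert_space
begin

definition scaleC_complex :: "complex \<Rightarrow> complex \<Rightarrow> complex"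
  where "scaleC_complex a x = a * x"

definition cinner_complex :: "complex \<Rightarrow> complex \<Rightarrow> complex"
  where "cinner_complex x y = x * cnj y"

instance
proof
  fix x :: complex
  show "cinner x x = complex_of_real ((norm x)\<^sup>2)"
    unfolding cinner_complex_def by (simp only: complex_norm_square)
qed (simp_all add: scaleC_complex_def cinner_complex_def algebra_simps scaleR_conv_of_real)

end

definition bounded_clinear :: "('a::complex_inner \<Rightarrow> 'b::complex_inner) \<Rightarrow> bool"
  where "bounded_clinear T \<longleftrightarrow> bounded_linear T \<and> (\<forall>c x. T (c *\<^sub>C x) = c *\<^sub>C T x)"

(* For a bounded operator on a Hilbert space such an S exists by Riesz representation;
   it is unique and automatically linear and bounded. For other T the value is unspecified. *)
definition cadjoint :: "('a::complex_inner \<Rightarrow> 'b::complex_inner) \<Rightarrow> 'b \<Rightarrow> 'a"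
  where "cadjoint T = (THE S. \<forall>x y. cinner (T x) y = cinner x (S y))"

lemma cadjoint_eqI:
  assumes S: "\<And>x y. cinner (T x) y = cinner x (S y)"
  shows "cadjoint T = S"
  unfolding cadjoint_def
proof (rule the_equality)
  show "\<forall>x y. cinner (T x) y = cinner x (S y)"
    using S by blast
next
  fix S' assume S': "\<forall>x y. cinner (T x) y = cinner x (S' y)"
  show "S' = S"
  proof
    fix y
    define d where "d = S' y - S y"
    have "cinner (S' y) d = cinner (S y) d"
      using S S' by (metis cinner_commute)
    moreover have "cinner (S' y) d = cinner d d + cinner (S y) d"
      unfolding cinner_add_left[symmetric] d_def by simp
    ultimately have "cinner d d = 0"
      by simp
    then have "d = 0"
      by (simp add: cinner_self)
    then show "S' y = S y"
      by (simp add: d_def)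
  qed
qed

definition quasinormal :: "('a::complex_inner \<Rightarrow> 'a) \<Rightarrow> bool"
  where "quasinormal T \<longleftrightarrow> T \<circ> (cadjoint T \<circ> T) = (cadjoint T \<circ> T) \<circ> T"

definition paranormal :: "('a::complex_inner \<Rightarrow> 'a) \<Rightarrow> bool"
  where "paranormal T \<longleftrightarrow> (\<forall>x. (norm (T x))\<^sup>2 \<le> norm ((T ^^ 2) x) * norm x)"

end

theory Submission
  imports Defs
begin

text \<open>
  Write \<open>S = T\<^sup>* T\<close>, \<open>Q = T ^ n\<close> and \<open>A = Q\<^sup>* Q\<close>. Then
  \<open>\<parallel>Q x\<parallel>\<^sup>2 = \<langle>A x, x\<rangle>\<close>. Quasinormality of \<open>Q\<close> says that \<open>A\<close> commutes with \<open>Q\<close>, so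
  \<open>\<parallel>Q (Q x)\<parallel> = \<parallel>A x\<parallel>\<close>.
  The heart of the proof is that \<open>S\<close> commutes with every operator that commutes, together with its
  adjoint, with \<open>A\<close>; in effect \<open>S\<close> is the \<open>n\<close>-th root of \<open>A\<close>, but no functional
  calculus is needed.

  Paranormality makes the sequence \<open>\<parallel>T ^ k x\<parallel>\<^sup>2\<close> logarithmically convex in \<open>k\<close>. Hence
  \<open>\<parallel>T ^ k x\<parallel>\<^sup>2 / t ^ k\<close> is convex for every \<open>t > 0\<close>, and comparing the indices
  \<open>0, 1, n, 2 n\<close> gives, with \<open>a = t ^ n\<close>,
  \<open>0 \<le> \<alpha> + \<beta> A - S \<le> \<gamma> (A - a)\<^sup>2\<close>,
  where \<open>\<alpha> + \<beta> s\<close> is the tangent of the function \<open>root n s\<close> at \<open>s = a\<close>. By the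
  Cauchy-Schwarz inequality for positive operators,
  \<open>\<parallel>(\<alpha> + \<beta> A - S) x\<parallel>\<close> is at most a constant times \<open>\<parallel>(A - a) x\<parallel>\<close>. If \<open>R\<close> commutes
  with \<open>A\<close>, the same kind of bound follows for the commutator \<open>Y = R S - S R\<close>. The constants
  blow up as \<open>a\<close> tends to \<open>0\<close>, but for \<open>Y A\<^sup>2\<close> they can be chosen uniformly in all
  real \<open>a\<close>.

  An operator \<open>Y\<close> with \<open>\<parallel>Y x\<parallel> \<le> K \<parallel>(A - a) x\<parallel>\<close> for all real \<open>a\<close> and all \<open>x\<close>
  vanishes (\<open>dominated_by_translates_eq_zero\<close>). The Cayley transform reduces this to a surjective
  isometry \<open>U\<close> in place of \<open>A\<close> and the points of the unit circle in place of the reals. There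
  the sums \<open>e = (\<Sum>j<N. w ^ j U ^ j)\<close> over the \<open>N\<close>-th roots of unity \<open>w\<close> act as
  approximate spectral projections: \<open>(U - cnj w) e\<close> has norm at most \<open>2\<close>, the sum of the
  \<open>w e\<^sup>2\<close> is \<open>N\<^sup>2 U ^ (N - 1)\<close>, and the sum of the \<open>\<parallel>e x\<parallel>\<^sup>2\<close> is
  \<open>N\<^sup>2 \<parallel>x\<parallel>\<^sup>2\<close>. Together these give \<open>\<parallel>Y y\<parallel> \<le> 2 K \<parallel>y\<parallel> / sqrt N\<close> for all \<open>N\<close>.

  So \<open>Y A\<^sup>2 = 0\<close>. Applying this to the adjoint of \<open>R\<close> shows that \<open>Y\<close> maps into the
  kernel of \<open>A\<close>, which lies in the kernel of \<open>S\<close>, and \<open>Y = 0\<close> follows. The choices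
  \<open>R = A\<close> and \<open>R = Q\<close> show that \<open>S\<close> commutes with \<open>A\<close> and \<open>Q\<close>. Expanding
  \<open>\<parallel>A T x - T A x\<parallel>\<^sup>2\<close> then gives \<open>A T = T A\<close>, and the choice \<open>R = T\<close> yields
  \<open>S T = T S\<close>.
\<close>

section \<open>Complex inner products\<close>

lemma scaleC_one [simp]: "1 *\<^sub>C (x::'a::complex_vector) = x"
  using scaleC_of_real[of 1 x] by simp

lemma scaleC_minus_one: "(-1) *\<^sub>C (x::'a::complex_vector) = - x"
  using scaleC_of_real[of "-1" x] by simp

lemma scaleR_commute_scaleC: "c *\<^sub>C (r *\<^sub>R x) = r *\<^sub>R (c *\<^sub>C (x::'a::complex_vector))"
  by (simp add: scaleC_of_real[symmetric] scaleC_scaleC mult.commute)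

lemma cinner_zero_left [simp]: "cinner 0 (x::'a::complex_inner) = 0"
  using cinner_add_left[of 0 0 x] by simp

lemma cinner_zero_right [simp]: "cinner (x::'a::complex_inner) 0 = 0"
  using cinner_commute[of x 0] by simp

lemma cinner_add_right: "cinner (x::'a::complex_inner) (y + z) = cinner x y + cinner x z"
  by (metis cinner_add_left cinner_commute complex_cnj_add)

lemma cinner_scaleC_right: "cinner (x::'a::complex_inner) (c *\<^sub>C y) = cnj c * cinner x y"
  by (metis cinner_scaleC_left cinner_commute complex_cnj_mult)

lemma cinner_minus_left: "cinner (- x::'a::complex_inner) y = - cinner x y"
  using cinner_scaleC_left[of "-1" x y] by (simp add: scaleC_minus_one)

lemma cinner_minus_right: "cinner (x::'a::complex_inner) (- y) = - cinner x y"
  by (metis cinner_minus_left cinner_commute complex_cnj_minus)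

lemma cinner_diff_left: "cinner (x - y::'a::complex_inner) z = cinner x z - cinner y z"
  using cinner_add_left[of x "- y" z] by (simp add: cinner_minus_left)

lemma cinner_diff_right: "cinner (x::'a::complex_inner) (y - z) = cinner x y - cinner x z"
  using cinner_add_right[of x y "- z"] by (simp add: cinner_minus_right)

lemma cinner_scaleR_left: "cinner (r *\<^sub>R x::'a::complex_inner) y = of_real r * cinner x y"
  by (simp add: scaleC_of_real[symmetric] cinner_scaleC_left)

lemma cinner_scaleR_right: "cinner (x::'a::complex_inner) (r *\<^sub>R y) = of_real r * cinner x y"
  by (simp add: scaleC_of_real[symmetric] cinner_scaleC_right)

lemmas cinner_simps = cinner_add_left cinner_add_right cinner_diff_left cinner_diff_right
  cinner_scaleC_left cinner_scaleC_right cinner_scaleR_left cinner_scaleR_right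

lemma Re_cinner_self: "Re (cinner (x::'a::complex_inner) x) = (norm x)\<^sup>2"
  by (simp add: cinner_self)

lemma Re_cinner_commute: "Re (cinner (x::'a::complex_inner) y) = Re (cinner y x)"
  by (metis cinner_commute cnj.sel(1))

lemma cinner_eqI:
  assumes "\<And>x. cinner x u = cinner x (v::'a::complex_inner)"
  shows "u = v"
proof -
  have "cinner (u - v) (u - v) = 0"
    using assms[of "u - v"] by (simp add: cinner_diff_right)
  then show ?thesis by (simp add: cinner_self)
qed

lemma norm_add_square:
  "(norm (x + y::'a::complex_inner))\<^sup>2 = (norm x)\<^sup>2 + 2 * Re (cinner x y) + (norm y)\<^sup>2"
  by (simp add: Re_cinner_self[symmetric] cinner_simps Re_cinner_commute[of y x])

lemma norm_diff_square:
  "(norm (x - y::'a::complex_inner))\<^sup>2 = (norm x)\<^sup>2 - 2 * Re (cinner x y) + (norm y)\<^sup>2"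
  by (simp add: Re_cinner_self[symmetric] cinner_simps Re_cinner_commute[of y x])

lemma norm_scaleC: "norm (c *\<^sub>C x::'a::complex_inner) = cmod c * norm x"
proof -
  have "complex_of_real ((norm (c *\<^sub>C x))\<^sup>2) = c * cnj c * cinner x x"
    by (simp only: cinner_self[symmetric] cinner_scaleC_left cinner_scaleC_right mult_ac)
  also have "\<dots> = complex_of_real ((cmod c * norm x)\<^sup>2)"
    by (simp only: cinner_self power_mult_distrib of_real_mult complex_norm_square)
  finally have "complex_of_real ((norm (c *\<^sub>C x))\<^sup>2) = complex_of_real ((cmod c * norm x)\<^sup>2)" .
  then have "(norm (c *\<^sub>C x))\<^sup>2 = (cmod c * norm x)\<^sup>2"
    by (simp only: of_real_eq_iff)
  then show ?thesis
    by (rule power2_eq_imp_eq) simp_all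
qed

text \<open>The triangle inequality is part of the norm axioms, so the Cauchy-Schwarz inequality
  can be read off from it.\<close>

lemma Re_cinner_le: "Re (cinner (x::'a::complex_inner) y) \<le> norm x * norm y"
proof -
  have "(norm (x + y))\<^sup>2 \<le> (norm x + norm y)\<^sup>2"
    by (intro power_mono norm_triangle_ineq) simp
  then show ?thesis
    by (simp add: norm_add_square power2_sum)
qed

lemma abs_Re_cinner_le: "\<bar>Re (cinner (x::'a::complex_inner) y)\<bar> \<le> norm x * norm y"
  using Re_cinner_le[of x y] Re_cinner_le[of "- x" y] by (simp add: cinner_minus_left abs_le_iff)

lemma bounded_linear_scaleC: "bounded_linear (\<lambda>x::'a::complex_inner. c *\<^sub>C x)"
  by (rule bounded_linear_intro[where K = "cmod c"])
     (simp_all add: scaleC_add_right scaleR_commute_scaleC norm_scaleC mult.commute)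

lemma scaleC_sum_right: "c *\<^sub>C (\<Sum>i\<in>I. f i) = (\<Sum>i\<in>I. c *\<^sub>C (f i::'a::complex_inner))"
  by (rule linear_sum[OF bounded_linear.linear[OF bounded_linear_scaleC]])

lemma scaleC_zero_left [simp]: "0 *\<^sub>C (x::'a::complex_vector) = 0"
  using scaleC_of_real[of 0 x] by simp

lemma scaleC_diff_right: "c *\<^sub>C (x - y) = c *\<^sub>C x - c *\<^sub>C (y::'a::complex_inner)"
  by (rule linear_diff[OF bounded_linear.linear[OF bounded_linear_scaleC]])

lemma scaleC_sum_left: "(\<Sum>i\<in>I. f i) *\<^sub>C x = (\<Sum>i\<in>I. f i *\<^sub>C (x::'a::complex_inner))"
  by (induction I rule: infinite_finite_induct) (simp_all add: scaleC_add_left)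

lemma scaleC_diff_left: "(a - b) *\<^sub>C x = a *\<^sub>C x - b *\<^sub>C (x::'a::complex_inner)"
  using scaleC_add_left[of "a - b" b x] by (simp add: algebra_simps)

lemma scaleC_minus_left: "(- a) *\<^sub>C x = - (a *\<^sub>C (x::'a::complex_inner))"
  using scaleC_diff_left[of 0 a x] by simp

lemma cinner_sum_left: "cinner (\<Sum>i\<in>I. f i) (y::'a::complex_inner) = (\<Sum>i\<in>I. cinner (f i) y)"
  by (induction I rule: infinite_finite_induct) (simp_all add: cinner_add_left)

lemma cinner_sum_right: "cinner (y::'a::complex_inner) (\<Sum>i\<in>I. f i) = (\<Sum>i\<in>I. cinner y (f i))"
  by (induction I rule: infinite_finite_induct) (simp_all add: cinner_add_right)

section \<open>Bounded complex-linear operators and adjoints\<close>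

lemma bounded_clinear_scaleC: "bounded_clinear T \<Longrightarrow> T (c *\<^sub>C x) = c *\<^sub>C T x"
  by (simp add: bounded_clinear_def)

lemma bounded_clinear_bounded_linear: "bounded_clinear T \<Longrightarrow> bounded_linear T"
  by (simp add: bounded_clinear_def)

lemma bounded_clinear_linear: "bounded_clinear T \<Longrightarrow> linear T"
  by (simp add: bounded_clinear_def bounded_linear.linear)

lemma bounded_clinear_compose:
  "bounded_clinear f \<Longrightarrow> bounded_clinear g \<Longrightarrow> bounded_clinear (\<lambda>x. f (g x))"
  by (simp add: bounded_clinear_def bounded_linear_compose)

lemma bounded_clinear_diff:
  "bounded_clinear f \<Longrightarrow> bounded_clinear g \<Longrightarrow> bounded_clinear (\<lambda>x. f x - g x)"
  by (simp add: bounded_clinear_def bounded_linear_sub scaleC_diff_right)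

lemma bounded_clinear_funpow:
  fixes f :: "'a::complex_inner \<Rightarrow> 'a"
  assumes "bounded_clinear f"
  shows "bounded_clinear (f ^^ n)"
proof (induction n)
  case 0
  then show ?case by (simp add: bounded_clinear_def id_def)
next
  case (Suc n)
  then show ?case using bounded_clinear_compose[OF assms Suc] by (simp add: o_def)
qed

lemma bounded_clinear_bound:
  assumes "bounded_clinear T"
  obtains K where "K \<ge> 0" "\<And>x. norm (T x) \<le> K * norm x"
  using bounded_linear.nonneg_bounded[OF bounded_clinear_bounded_linear[OF assms]]
  by (metis mult.commute)

text \<open>The real form of the Riesz representation theorem: the representing vector is the
  minimizer of \<open>\<phi> x = \<parallel>x\<parallel>\<^sup>2 - 2 f x\<close>.\<close>

lemma riesz_real:
  fixes f :: "'a::complex_hilbert_space \<Rightarrow> real"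
  assumes f: "bounded_linear f"
  shows "\<exists>z. \<forall>x. f x = Re (cinner x z)"
proof -
  interpret bounded_linear f by (rule f)
  define \<phi> where "\<phi> x = (norm x)\<^sup>2 - 2 * f x" for x
  obtain K where K: "\<And>x. norm (f x) \<le> norm x * K"
    using bounded by blast
  have below: "- (K\<^sup>2) \<le> \<phi> x" for x
  proof -
    have "f x \<le> norm x * K" using K[of x] by simp
    moreover have "0 \<le> (norm x - K)\<^sup>2" by simp
    ultimately show ?thesis by (simp add: \<phi>_def power2_diff)
  qed
  define m where "m = (INF x. \<phi> x)"
  have bdd: "bdd_below (range \<phi>)" using below by (auto simp: bdd_below_def)
  have m_le: "m \<le> \<phi> x" for x
    unfolding m_def by (rule cINF_lower[OF bdd]) simp
  have "\<exists>x. \<phi> x < m + 1 / real (Suc k)" for k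
    using cINF_less_iff[of UNIV \<phi> "m + 1 / real (Suc k)"] bdd by (simp add: m_def)
  then obtain X where X: "\<And>k. \<phi> (X k) < m + 1 / real (Suc k)" by metis
  \<comment> \<open>The parallelogram law at the midpoint makes minimizing sequences Cauchy.\<close>
  have mid: "(norm (u - v))\<^sup>2 \<le> 2 * (\<phi> u - m) + 2 * (\<phi> v - m)" for u v
  proof -
    have "m \<le> \<phi> ((1/2) *\<^sub>R (u + v))" by (rule m_le)
    also have "\<dots> = (norm (u + v))\<^sup>2 / 4 - f u - f v"
      by (simp add: \<phi>_def scaleR add power_divide; simp add: field_simps)
    finally show ?thesis
      unfolding \<phi>_def norm_add_square norm_diff_square by argo
  qed
  have "Cauchy X"
  proof (rule metric_CauchyI)
    fix e :: real assume e: "e > 0"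
    obtain M where M: "1 / real (Suc M) < e\<^sup>2 / 4"
      using e nat_approx_posE[of "e\<^sup>2 / 4"] by auto
    have small: "\<phi> (X i) < m + e\<^sup>2 / 4" if "i \<ge> M" for i
    proof -
      have "1 / real (Suc i) \<le> 1 / real (Suc M)"
        using that by (simp add: frac_le)
      then show ?thesis using X[of i] M by linarith
    qed
    have "dist (X i) (X j) < e" if "i \<ge> M" "j \<ge> M" for i j
    proof -
      have "(norm (X i - X j))\<^sup>2 < e\<^sup>2"
        using mid[of "X i" "X j"] small[OF that(1)] small[OF that(2)] by argo
      then show ?thesis
        using e by (simp add: dist_norm power2_less_imp_less)
    qed
    then show "\<exists>M. \<forall>i\<ge>M. \<forall>j\<ge>M. dist (X i) (X j) < e" by blast
  qed
  then obtain z where z: "X \<longlonglongrightarrow> z"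
    using Cauchy_convergent convergent_def by blast
  have "(\<lambda>k. \<phi> (X k)) \<longlonglongrightarrow> \<phi> z"
    unfolding \<phi>_def by (intro tendsto_intros tendsto z)
  moreover have "(\<lambda>k. m + 1 / real (Suc k)) \<longlonglongrightarrow> m + 0"
    by (intro tendsto_intros LIMSEQ_Suc[OF lim_1_over_n])
  ultimately have "\<phi> z \<le> m + 0"
    by (rule LIMSEQ_le) (use X less_imp_le in blast)
  then have min: "\<phi> z \<le> \<phi> x" for x using m_le[of x] by simp
  \<comment> \<open>The first variation of \<open>\<phi>\<close> at \<open>z\<close> in the direction \<open>x\<close> vanishes.\<close>
  have "f x = Re (cinner x z)" for x
  proof (rule ccontr)
    assume ne: "f x \<noteq> Re (cinner x z)"
    define d where "d = f x - Re (cinner x z)"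
    have key: "2 * t * d \<le> t\<^sup>2 * (norm x)\<^sup>2" for t
      using min[of "z + t *\<^sub>R x"]
      by (simp add: \<phi>_def norm_add_square cinner_simps add scaleR d_def Re_cinner_commute[of z x]
          power_mult_distrib algebra_simps)
    have xn: "norm x \<noteq> 0" using ne zero by auto
    have "2 * (d / (norm x)\<^sup>2) * d \<le> (d / (norm x)\<^sup>2)\<^sup>2 * (norm x)\<^sup>2"
      by (rule key)
    then have "2 * d\<^sup>2 \<le> d\<^sup>2"
      using xn by (simp add: field_simps power2_eq_square)
    then show False using ne by (simp add: d_def)
  qed
  then show ?thesis by blast
qed

lemma adjoint_exists:
  fixes T :: "'a::complex_hilbert_space \<Rightarrow> 'a"
  assumes T: "bounded_clinear T"
  obtains T' where "bounded_clinear T'" "\<And>x y. cinner (T x) y = cinner x (T' y)"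
proof -
  obtain K where K: "K \<ge> 0" "\<And>x. norm (T x) \<le> K * norm x"
    using bounded_clinear_bound[OF T] by blast
  note lin = bounded_clinear_linear[OF T]
  have "\<exists>z. \<forall>x. cinner (T x) y = cinner x z" for y
  proof -
    have "bounded_linear (\<lambda>x. Re (cinner (T x) y))"
    proof (rule bounded_linear_intro[where K = "K * norm y"])
      fix x
      have "\<bar>Re (cinner (T x) y)\<bar> \<le> norm (T x) * norm y" by (rule abs_Re_cinner_le)
      also have "\<dots> \<le> K * norm x * norm y" by (intro mult_right_mono K) simp
      finally show "norm (Re (cinner (T x) y)) \<le> norm x * (K * norm y)"
        by (simp add: mult_ac)
    qed (simp_all add: linear_add[OF lin] linear_cmul[OF lin] cinner_simps)
    then obtain z where z: "\<And>x. Re (cinner (T x) y) = Re (cinner x z)"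
      using riesz_real by blast
    have "cinner (T x) y = cinner x z" for x
      \<comment> \<open>The imaginary parts agree because the real parts agree at \<open>\<i> x\<close>.\<close>
      using z[of x] z[of "\<i> *\<^sub>C x"]
      by (simp add: bounded_clinear_scaleC[OF T] cinner_simps complex_eq_iff)
    then show ?thesis by blast
  qed
  then obtain T' where T': "\<And>x y. cinner (T x) y = cinner x (T' y)" by metis
  have scale: "T' (c *\<^sub>C y) = c *\<^sub>C T' y" for c y
    by (rule cinner_eqI) (simp add: T'[symmetric] cinner_simps)
  have "bounded_linear T'"
  proof (rule bounded_linear_intro[where K = K])
    show "T' (x + y) = T' x + T' y" for x y
      by (rule cinner_eqI) (simp add: T'[symmetric] cinner_simps)
    show "T' (r *\<^sub>R x) = r *\<^sub>R T' x" for r x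
      using scale[of "of_real r" x] by (simp add: scaleC_of_real)
    fix y
    have "(norm (T' y))\<^sup>2 = Re (cinner (T (T' y)) y)"
      by (simp add: T' Re_cinner_self)
    also have "\<dots> \<le> norm (T (T' y)) * norm y" by (rule Re_cinner_le)
    also have "\<dots> \<le> K * norm (T' y) * norm y" by (intro mult_right_mono K) simp
    finally have "norm (T' y) * norm (T' y) \<le> norm (T' y) * (norm y * K)"
      by (simp add: power2_eq_square mult_ac)
    then show "norm (T' y) \<le> norm y * K"
      using K(1) by (cases "norm (T' y) = 0") (simp_all add: mult_le_cancel_left)
  qed
  then have "bounded_clinear T'" using scale by (simp add: bounded_clinear_def)
  then show ?thesis using T' that by blast
qed

lemma adjoint_swap:
  assumes "\<And>x y. cinner (T x) y = cinner x (T' y)"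
  shows "cinner (T' (x::'a::complex_inner)) y = cinner x (T (y::'a))"
  by (metis assms cinner_commute)

lemma adjoint_funpow:
  fixes T T' :: "'a::complex_inner \<Rightarrow> 'a"
  assumes "\<And>x y. cinner (T x) y = cinner x (T' y)"
  shows "cinner ((T ^^ n) x) y = cinner x ((T' ^^ n) y)"
  by (induction n arbitrary: x) (simp_all add: assms funpow_swap1[of T] funpow_swap1[of T'])

text \<open>This is the Cauchy-Schwarz inequality for the positive form \<open>\<langle>P x, y\<rangle>\<close>; it is obtained
  by evaluating the form at \<open>x - P x / C\<close>.\<close>

lemma positive_norm_square_le:
  fixes P :: "'a::complex_inner \<Rightarrow> 'a"
  assumes lin: "linear P"
    and sym: "\<And>x y. cinner (P x) y = cinner x (P y)"
    and pos: "\<And>x. 0 \<le> Re (cinner (P x) x)"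
    and le: "\<And>x. Re (cinner (P x) x) \<le> C * (norm x)\<^sup>2"
    and C: "C > 0"
  shows "(norm (P x))\<^sup>2 \<le> C * Re (cinner (P x) x)"
proof -
  define s where "s = (norm (P x))\<^sup>2"
  define y where "y = x - (1 / C) *\<^sub>R P x"
  have "0 \<le> Re (cinner (P y) y)" by (rule pos)
  also have "\<dots> = Re (cinner (P x) x) - 2 / C * s + (1 / C)\<^sup>2 * Re (cinner (P (P x)) (P x))"
    by (simp add: y_def linear_diff[OF lin] linear_cmul[OF lin] cinner_simps s_def
        sym[of "P x" x] Re_cinner_self power2_eq_square algebra_simps)
  also have "\<dots> \<le> Re (cinner (P x) x) - 2 / C * s + (1 / C)\<^sup>2 * (C * s)"
    unfolding s_def by (intro add_left_mono mult_left_mono le) simp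
  finally show ?thesis
    using C by (simp add: s_def field_simps power2_eq_square)
qed

section \<open>Operators dominated by all translates of a selfadjoint operator\<close>

lemma sum_roots_of_unity_power:
  assumes N: "N > 0"
  shows "(\<Sum>k<N. (cis (2 * pi * real k / real N)) ^ m) = (if N dvd m then of_nat N else 0)"
proof -
  define z where "z = cis (2 * pi * real m / real N)"
  have pow: "(cis (2 * pi * real k / real N)) ^ m = z ^ k" for k
    by (simp add: z_def Complex.DeMoivre mult_ac)
  have zN: "z ^ N = 1"
    using N by (simp add: z_def Complex.DeMoivre)
  have z1: "z = 1 \<longleftrightarrow> N dvd m"
  proof
    assume "N dvd m"
    then obtain q where "m = N * q" ..
    then have "2 * pi * real m / real N = 2 * pi * real q" using N by simp
    then have "z = cis (2 * pi * real q)" by (simp only: z_def)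
    also have "\<dots> = 1" by (rule cis_multiple_2pi) simp
    finally show "z = 1" .
  next
    assume "z = 1"
    then have "cos (2 * pi * real m / real N) = 1" by (simp add: z_def complex_eq_iff)
    then obtain q :: int where "2 * pi * real m / real N = of_int q * 2 * pi"
      using cos_one_2pi_int by blast
    then have "real m = of_int q * real N" using N by (simp add: field_simps)
    then have "int m = q * int N"
      by (metis of_int_eq_iff of_int_mult of_int_of_nat_eq)
    then show "N dvd m" by (metis dvd_triv_right int_dvd_int_iff)
  qed
  show ?thesis
  proof (cases "N dvd m")
    case True
    then show ?thesis using z1 by (simp add: pow)
  next
    case False
    then have "z \<noteq> 1" using z1 by simp
    then have "(\<Sum>k<N. z ^ k) = 0" using geometric_sum[of z N] zN by simp
    then show ?thesis using False by (simp add: pow)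
  qed
qed


text \<open>A bounded operator \<open>Y\<close> annihilates approximate eigenvectors of \<open>U\<close> as soon as it is
  dominated by all \<open>U - w\<close> with \<open>w\<close> on the unit circle. Decomposing a vector into \<open>N\<close>
  approximate eigenvectors with error \<open>1 / N\<close> each would only give a bounded total error if
  estimated one by one; squaring the approximate projections \<open>e k\<close> and using the Parseval
  identity gains the factor \<open>1 / sqrt N\<close>.\<close>

lemma isometry_dominated_eq_zero:
  fixes U Y :: "'a::complex_inner \<Rightarrow> 'a"
  assumes U: "bounded_clinear U" and iso: "\<And>x. norm (U x) = norm x" and "surj U"
    and Y: "bounded_clinear Y" and K: "K \<ge> 0"
    and dom: "\<And>w x. cmod w = 1 \<Longrightarrow> norm (Y x) \<le> K * norm (U x - w *\<^sub>C x)"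
  shows "Y y = 0"
proof -
  note linU = bounded_clinear_linear[OF U] and linY = bounded_clinear_linear[OF Y]
  have Upow: "bounded_clinear (U ^^ j)" for j
    by (rule bounded_clinear_funpow[OF U])
  have isopow: "norm ((U ^^ j) x) = norm x" for j x
    by (induction j) (simp_all add: iso)
  have bound: "norm (Y y) * sqrt (real N) \<le> 2 * K * norm y" if N: "N > 0" for N
  proof -
    define w where "w k = cis (2 * pi * real k / real N)" for k :: nat
    define e where "e k x = (\<Sum>j<N. w k ^ j *\<^sub>C (U ^^ j) x)" for k x
    have norm_w: "cmod (w k) = 1" for k by (simp add: w_def)
    have cnj_w: "cnj (w k) * w k = 1" for k
      using complex_norm_square[of "w k"] norm_w[of k] by (simp add: mult.commute)
    have w_sum: "(\<Sum>k<N. w k ^ m) = (if N dvd m then of_nat N else 0)" for m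
      unfolding w_def by (rule sum_roots_of_unity_power[OF N])
    have w_N: "w k ^ N = 1" for k
    proof -
      have "w k ^ N = cis (2 * pi * real k)"
        using N by (simp add: w_def Complex.DeMoivre)
      then show ?thesis using cis_multiple_2pi[of "real k"] by (simp add: mult.assoc)
    qed
    \<comment> \<open>The geometric sum telescopes.\<close>
    have U_e: "U (e k x) - cnj (w k) *\<^sub>C e k x = cnj (w k) *\<^sub>C ((U ^^ N) x - x)" for k x
    proof -
      have "w k *\<^sub>C U (e k x) - e k x
          = (\<Sum>j<N. w k ^ Suc j *\<^sub>C (U ^^ Suc j) x - w k ^ j *\<^sub>C (U ^^ j) x)"
        by (simp add: e_def linear_sum[OF linU] bounded_clinear_scaleC[OF U] scaleC_sum_right
            scaleC_scaleC sum_subtractf)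
      also have "\<dots> = w k ^ N *\<^sub>C (U ^^ N) x - x"
        by (subst sum_lessThan_telescope) simp
      finally have "w k *\<^sub>C U (e k x) - e k x = (U ^^ N) x - x" by (simp add: w_N)
      then have "cnj (w k) *\<^sub>C (w k *\<^sub>C U (e k x) - e k x) = cnj (w k) *\<^sub>C ((U ^^ N) x - x)"
        by simp
      then show ?thesis by (simp add: scaleC_diff_right scaleC_scaleC cnj_w)
    qed
    have Y_e: "norm (Y (e k x)) \<le> 2 * K * norm x" for k x
    proof -
      have "norm (Y (e k x)) \<le> K * norm (U (e k x) - cnj (w k) *\<^sub>C e k x)"
        by (rule dom) (simp add: norm_w)
      also have "\<dots> = K * norm ((U ^^ N) x - x)"
        by (simp add: U_e norm_scaleC norm_w)
      also have "\<dots> \<le> K * (norm ((U ^^ N) x) + norm x)"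
        by (intro mult_left_mono norm_triangle_ineq4 K)
      finally show ?thesis by (simp add: isopow mult_ac)
    qed
    have parseval: "(\<Sum>k<N. (norm (e k x))\<^sup>2) = (real N)\<^sup>2 * (norm x)\<^sup>2" for x
    proof -
      have orth: "(\<Sum>k<N. w k ^ j * cnj (w k) ^ l) = (if j = l then of_nat N else 0)"
        if "j < N" "l < N" for j l
      proof -
        have "cnj (w k) ^ l = w k ^ (N - l)" for k
        proof -
          have "cnj (w k) ^ l = cnj (w k) ^ l * w k ^ N" by (simp add: w_N)
          also have "\<dots> = (cnj (w k) * w k) ^ l * w k ^ (N - l)"
            using that by (simp add: power_mult_distrib mult.assoc power_add[symmetric])
          finally show ?thesis by (simp add: cnj_w)
        qed
        then have "(\<Sum>k<N. w k ^ j * cnj (w k) ^ l) = (\<Sum>k<N. w k ^ (j + (N - l)))"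
          by (simp add: power_add)
        moreover have "N dvd j + (N - l) \<longleftrightarrow> j = l"
        proof
          assume "N dvd j + (N - l)"
          then obtain q where q: "j + (N - l) = N * q" ..
          have "0 < q" using q that by (cases q) auto
          moreover have "N * q < N * 2" using q that by linarith
          ultimately have "q = 1" by simp
          then show "j = l" using q that by simp
        qed (use that in simp)
        ultimately show ?thesis by (simp add: w_sum)
      qed
      have "complex_of_real (\<Sum>k<N. (norm (e k x))\<^sup>2) = (\<Sum>k<N. cinner (e k x) (e k x))"
        by (simp add: cinner_self)
      also have "\<dots> = (\<Sum>k<N. \<Sum>j<N. \<Sum>l<N.
          (w k ^ j * cnj (w k) ^ l) * cinner ((U ^^ j) x) ((U ^^ l) x))"
        unfolding e_def
        by (subst cinner_sum_left, subst cinner_sum_right)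
           (simp only: cinner_scaleC_left cinner_scaleC_right complex_cnj_power mult_ac)
      also have "\<dots> = (\<Sum>j<N. \<Sum>l<N. \<Sum>k<N.
          (w k ^ j * cnj (w k) ^ l) * cinner ((U ^^ j) x) ((U ^^ l) x))"
        by (rule trans[OF sum.swap], rule sum.cong[OF refl], rule sum.swap)
      also have "\<dots> = (\<Sum>j<N. \<Sum>l<N.
          (if j = l then of_nat N else 0) * cinner ((U ^^ j) x) ((U ^^ l) x))"
        by (intro sum.cong refl) (simp only: sum_distrib_right[symmetric] orth lessThan_iff)
      also have "\<dots> = (\<Sum>j<N. of_nat N * cinner ((U ^^ j) x) ((U ^^ j) x))"
        by (intro sum.cong refl) (simp add: if_distrib[of "\<lambda>c. c * _"] cong: if_cong)
      also have "\<dots> = complex_of_real ((real N)\<^sup>2 * (norm x)\<^sup>2)"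
        by (simp add: cinner_self isopow power2_eq_square)
      finally show ?thesis by (simp only: of_real_eq_iff)
    qed
    have sum_e: "(\<Sum>k<N. norm (e k x)) \<le> sqrt (real N) * (real N * norm x)" for x
    proof (rule power2_le_imp_le)
      have "(\<Sum>k<N. norm (e k x))\<^sup>2 \<le> (\<Sum>k<N. (norm (e k x))\<^sup>2) * real (card {..<N})"
        by (rule sum_squared_le_sum_of_squares)
      then show "(\<Sum>k<N. norm (e k x))\<^sup>2 \<le> (sqrt (real N) * (real N * norm x))\<^sup>2"
        by (simp add: parseval power_mult_distrib mult_ac)
    qed simp
    \<comment> \<open>Of the coefficients \<open>w k ^ (j + l + 1)\<close>, only those with \<open>j + l = N - 1\<close> survive the
      summation over \<open>k\<close>.\<close>
    have sq_sum: "(\<Sum>k<N. w k *\<^sub>C e k (e k x)) = (of_nat N)\<^sup>2 *\<^sub>C (U ^^ (N - 1)) x" for x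
    proof -
      have coef: "(\<Sum>k<N. w k ^ (j + l + 1)) = (if l = N - 1 - j then of_nat N else 0)"
        if "j < N" "l < N" for j l
      proof -
        have "N dvd j + l + 1 \<longleftrightarrow> l = N - 1 - j"
        proof
          assume "N dvd j + l + 1"
          then obtain q where q: "j + l + 1 = N * q" ..
          have "0 < q" using q by (cases q) auto
          moreover have "N * q < N * 2" using q that by linarith
          ultimately have "q = 1" by simp
          then show "l = N - 1 - j" using q that by simp
        qed (use that in simp)
        then show ?thesis by (simp only: w_sum)
      qed
      have "(\<Sum>k<N. w k *\<^sub>C e k (e k x))
          = (\<Sum>k<N. \<Sum>j<N. \<Sum>l<N. w k ^ (j + l + 1) *\<^sub>C (U ^^ (j + l)) x)"
        by (simp add: e_def linear_sum[OF bounded_clinear_linear[OF Upow]]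
            bounded_clinear_scaleC[OF Upow] scaleC_sum_right scaleC_scaleC funpow_add power_add
            mult_ac)
      also have "\<dots> = (\<Sum>j<N. \<Sum>l<N. \<Sum>k<N. w k ^ (j + l + 1) *\<^sub>C (U ^^ (j + l)) x)"
        by (rule trans[OF sum.swap], rule sum.cong[OF refl], rule sum.swap)
      also have "\<dots> = (\<Sum>j<N. \<Sum>l<N. (if l = N - 1 - j then of_nat N else 0) *\<^sub>C (U ^^ (j + l)) x)"
        by (intro sum.cong refl) (simp only: scaleC_sum_left[symmetric] coef lessThan_iff)
      also have "\<dots> = (\<Sum>j<N. \<Sum>l<N. if l = N - 1 - j then of_nat N *\<^sub>C (U ^^ (j + l)) x else 0)"
        by (intro sum.cong refl) simp
      also have "\<dots> = (\<Sum>j<N. of_nat N *\<^sub>C (U ^^ (N - 1)) x)"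
        by (intro sum.cong refl) (auto simp: N)
      also have "\<dots> = (of_nat N)\<^sup>2 *\<^sub>C (U ^^ (N - 1)) x"
        by (simp add: scaleC_of_real[symmetric] scaleC_scaleC power2_eq_square sum_constant_scaleR)
      finally show ?thesis .
    qed
    obtain x where x: "(U ^^ (N - 1)) x = y"
      using \<open>surj U\<close> by (metis surj_fn surjE)
    have "(real N)\<^sup>2 * norm (Y y) = norm (Y ((of_nat N)\<^sup>2 *\<^sub>C (U ^^ (N - 1)) x))"
      by (simp only: bounded_clinear_scaleC[OF Y] norm_scaleC x norm_power norm_of_nat)
    also have "\<dots> = norm (\<Sum>k<N. w k *\<^sub>C Y (e k (e k x)))"
      unfolding sq_sum[symmetric] by (simp add: linear_sum[OF linY] bounded_clinear_scaleC[OF Y])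
    also have "\<dots> \<le> (\<Sum>k<N. norm (Y (e k (e k x))))"
      by (rule order_trans[OF norm_sum]) (simp add: norm_scaleC norm_w)
    also have "\<dots> \<le> (\<Sum>k<N. 2 * K * norm (e k x))"
      by (intro sum_mono Y_e)
    also have "\<dots> \<le> 2 * K * (sqrt (real N) * (real N * norm x))"
      unfolding sum_distrib_left[symmetric] by (intro mult_left_mono sum_e) (simp add: K)
    also have "norm x = norm y" using x isopow by metis
    finally have le: "(real N)\<^sup>2 * norm (Y y) \<le> 2 * K * (sqrt (real N) * (real N * norm y))" .
    have eq: "(real N)\<^sup>2 * norm (Y y)
        = (real N * sqrt (real N)) * (norm (Y y) * sqrt (real N))"
      using real_sqrt_mult_self[of "real N"] by (simp add: power2_eq_square)
    have "(real N * sqrt (real N)) * (norm (Y y) * sqrt (real N))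
        \<le> (real N * sqrt (real N)) * (2 * K * norm y)"
      unfolding eq[symmetric] using le by (simp add: mult_ac)
    then show ?thesis
      using N by (simp add: mult_le_cancel_left_pos)
  qed
  show ?thesis
  proof (rule ccontr)
    assume "Y y \<noteq> 0"
    then have pos: "norm (Y y) > 0" by simp
    obtain N :: nat where N: "(2 * K * norm y / norm (Y y))\<^sup>2 < real N"
      using reals_Archimedean2 by blast
    then have "N > 0" by (metis gr0I not_less of_nat_0 zero_le_power2)
    have "2 * K * norm y / norm (Y y) < sqrt (real N)"
      using N by (rule real_less_rsqrt)
    then show False
      using bound[OF \<open>N > 0\<close>] pos by (simp add: field_simps)
  qed
qed


lemma symmetric_add_imaginary_norm:
  fixes A :: "'a::complex_inner \<Rightarrow> 'a"
  assumes sym: "\<And>x y. cinner (A x) y = cinner x (A y)"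
  shows "(norm (A x + (\<i> * of_real c) *\<^sub>C x))\<^sup>2 = (norm (A x))\<^sup>2 + c\<^sup>2 * (norm x)\<^sup>2"
proof -
  have "Im (cinner (A x) x) = 0"
    by (metis sym cinner_commute Reals_cnj_iff complex_is_Real_iff)
  then show ?thesis
    by (simp add: norm_add_square cinner_simps norm_scaleC norm_mult power_mult_distrib)
qed

text \<open>The solution is the fixed point of the contraction \<open>x \<mapsto> (y - A x) / d\<close>.\<close>

lemma surj_add_scaleC:
  fixes A :: "'a::complex_hilbert_space \<Rightarrow> 'a"
  assumes A: "bounded_clinear A" and L: "\<And>x. norm (A x) \<le> L * norm x" and d: "L < cmod d" "L \<ge> 0"
  shows "\<exists>x. A x + d *\<^sub>C x = y"
proof -
  have d0: "d \<noteq> 0" using d by auto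
  define f where "f x = inverse d *\<^sub>C (y - A x)" for x
  have "\<exists>!x. f x = x"
  proof (rule banach_fix_type)
    show "0 \<le> L / cmod d" "L / cmod d < 1" using d by (simp_all add: divide_simps)
    show "\<forall>u v. dist (f u) (f v) \<le> L / cmod d * dist u v"
    proof (intro allI)
      fix u v
      have "f u - f v = inverse d *\<^sub>C A (v - u)"
        by (simp add: f_def scaleC_diff_right linear_diff[OF bounded_clinear_linear[OF A]])
      then have "dist (f u) (f v) = norm (A (v - u)) / cmod d"
        by (simp only: dist_norm norm_scaleC norm_inverse divide_inverse mult.commute)
      also have "\<dots> \<le> L * norm (v - u) / cmod d" by (intro divide_right_mono L) simp
      finally show "dist (f u) (f v) \<le> L / cmod d * dist u v"
        by (simp add: dist_norm norm_minus_commute)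
    qed
  qed
  then obtain x where x: "inverse d *\<^sub>C (y - A x) = x" unfolding f_def by blast
  then have "d *\<^sub>C (inverse d *\<^sub>C (y - A x)) = d *\<^sub>C x" by simp
  then have "y - A x = d *\<^sub>C x" using d0 by (simp add: scaleC_scaleC)
  then show ?thesis by (metis add.commute diff_add_cancel)
qed

text \<open>If \<open>A\<close> were diagonal, \<open>Y\<close> would clearly vanish on all eigenvectors. In general, the
  Cayley transform \<open>U\<close>, which maps \<open>(A + \<i> c) x\<close> to \<open>(A - \<i> c) x\<close>, is a surjective
  isometry, and the domination by the translates of \<open>A\<close> turns into the
  hypothesis of \<open>isometry_dominated_eq_zero\<close>.\<close>

lemma dominated_by_translates_eq_zero:
  fixes A Y :: "'a::complex_hilbert_space \<Rightarrow> 'a"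
  assumes A: "bounded_clinear A" and sym: "\<And>x y. cinner (A x) y = cinner x (A y)"
    and Y: "bounded_clinear Y" and K: "K \<ge> 0"
    and dom: "\<And>(a::real) x. norm (Y x) \<le> K * norm (A x - a *\<^sub>R x)"
  shows "Y y = 0"
proof -
  obtain L where L: "L \<ge> 0" "\<And>x. norm (A x) \<le> L * norm x"
    using bounded_clinear_bound[OF A] by blast
  obtain KY where KY: "KY \<ge> 0" "\<And>x. norm (Y x) \<le> KY * norm x"
    using bounded_clinear_bound[OF Y] by blast
  define c where "c = 2 * L + 1"
  have c: "c \<ge> 1" "L < c" "L \<le> c / 2" using L by (simp_all add: c_def)
  define P where "P x = A x + (\<i> * of_real c) *\<^sub>C x" for x
  define M where "M x = A x + (\<i> * of_real (- c)) *\<^sub>C x" for x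
  note linA = bounded_clinear_linear[OF A]
  have normP: "(norm (P x))\<^sup>2 = (norm (A x))\<^sup>2 + c\<^sup>2 * (norm x)\<^sup>2" for x
    unfolding P_def by (rule symmetric_add_imaginary_norm[OF sym])
  have normM: "norm (M x) = norm (P x)" for x
  proof -
    have "(norm (M x))\<^sup>2 = (norm (P x))\<^sup>2"
      unfolding normP M_def using symmetric_add_imaginary_norm[OF sym, of x "- c"] by simp
    then show ?thesis by (rule power2_eq_imp_eq) simp_all
  qed
  have P_add: "P (x + y) = P x + P y" and M_add: "M (x + y) = M x + M y" for x y
    by (simp_all add: P_def M_def linear_add[OF linA] scaleC_add_right)
  have P_scale: "P (r *\<^sub>C x) = r *\<^sub>C P x" and M_scale: "M (r *\<^sub>C x) = r *\<^sub>C M x" for r x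
    by (simp_all add: P_def M_def bounded_clinear_scaleC[OF A] scaleC_add_right scaleC_scaleC mult_ac)
  have P_zero: "x = 0" if "P x = 0" for x
    using normP[of x] that c by (simp add: add_nonneg_eq_0_iff)
  have "inj P"
  proof (rule injI)
    fix x y assume "P x = P y"
    then have "P (x + (-1) *\<^sub>C y) = 0" by (simp only: P_add P_scale) (simp add: scaleC_minus_one)
    then show "x = y" using P_zero by (force simp: scaleC_minus_one)
  qed
  have surjP: "surj P" and surjM: "surj M"
    using surj_add_scaleC[OF A L(2), of "\<i> * of_real c"] surj_add_scaleC[OF A L(2), of "\<i> * of_real (- c)"] c L(1)
    by (simp_all add: surj_def P_def M_def norm_mult) (metis)+
  define U where "U z = M (inv P z)" for z
  have U_P: "U (P x) = M x" for x by (simp add: U_def \<open>inj P\<close>)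
  have isoU: "norm (U z) = norm z" for z
    using surjP U_P normM by (metis surjE)
  have U: "bounded_clinear U"
  proof -
    have add: "U (x + y) = U x + U y" for x y
      using surjP by (metis surjE U_P P_add M_add)
    have scale: "U (r *\<^sub>C x) = r *\<^sub>C U x" for r x
      using surjP by (metis surjE U_P P_scale M_scale)
    have "bounded_linear U"
      by (rule bounded_linear_intro[where K = 1])
         (use add scale in \<open>simp_all add: isoU scaleC_of_real[symmetric]\<close>)
    then show ?thesis using scale by (simp add: bounded_clinear_def)
  qed
  have "surj U" using surjM U_P by (metis surj_def)
  define K' where "K' = 2 * (KY + K) * (2 * c)"
  have P_le: "norm (P x) \<le> 2 * c * norm x" for x
  proof (rule power2_le_imp_le)
    have "(norm (A x))\<^sup>2 \<le> (c * norm x)\<^sup>2"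
      using L(2)[of x] c(2) by (intro power_mono order_trans[OF L(2)] mult_right_mono) auto
    moreover have "0 \<le> (c * norm x)\<^sup>2" by simp
    moreover have "(2 * c * norm x)\<^sup>2 = 4 * (c * norm x)\<^sup>2" by (simp add: power_mult_distrib)
    moreover have "(norm (P x))\<^sup>2 = (norm (A x))\<^sup>2 + (c * norm x)\<^sup>2"
      by (simp add: normP power_mult_distrib)
    ultimately show "(norm (P x))\<^sup>2 \<le> (2 * c * norm x)\<^sup>2" by linarith
  qed (use c in simp)
  have domU: "norm (Y z) \<le> K' * norm (U z - w *\<^sub>C z)" if w: "cmod w = 1" for w z
  proof -
    obtain x where x: "z = P x" using surjP by (metis surjE)
    have diff: "U z - w *\<^sub>C z = (1 - w) *\<^sub>C A x - (\<i> * of_real c * (1 + w)) *\<^sub>C x"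
    proof -
      have "U z - w *\<^sub>C z = (A x - w *\<^sub>C A x) - ((\<i> * of_real c) *\<^sub>C x + (w * (\<i> * of_real c)) *\<^sub>C x)"
        unfolding x U_P by (simp add: M_def P_def scaleC_add_right scaleC_scaleC scaleC_minus_left)
      also have "\<dots> = (1 - w) *\<^sub>C A x - (\<i> * of_real c + w * (\<i> * of_real c)) *\<^sub>C x"
        by (simp only: scaleC_diff_left scaleC_add_left scaleC_one)
      also have "\<i> * of_real c + w * (\<i> * of_real c) = \<i> * of_real c * (1 + w)"
        by (simp add: distrib_left)
      finally show ?thesis .
    qed
    show ?thesis
    proof (cases "cmod (1 - w) \<le> 1")
      \<comment> \<open>Near \<open>w = 1\<close>, which corresponds to \<open>a = \<infinity>\<close>, the operator \<open>U - w\<close> is bounded below,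
        since \<open>c\<close> is at least twice the norm of \<open>A\<close>.\<close>
      case True
      have "cmod (1 + w) \<ge> 1"
        using norm_triangle_ineq[of "1 - w" "1 + w"] True by simp
      then have "c * norm x \<le> c * cmod (1 + w) * norm x"
        using c by (intro mult_right_mono) auto
      also have "\<dots> = norm ((\<i> * of_real c * (1 + w)) *\<^sub>C x)"
        using c by (simp add: norm_scaleC norm_mult)
      also have "\<dots> \<le> norm ((1 - w) *\<^sub>C A x) + norm (U z - w *\<^sub>C z)"
        unfolding diff using norm_triangle_sub[of "(\<i> * of_real c * (1 + w)) *\<^sub>C x" "(1 - w) *\<^sub>C A x"]
        by (simp add: norm_minus_commute)
      also have "norm ((1 - w) *\<^sub>C A x) \<le> 1 * (L * norm x)"
        unfolding norm_scaleC by (intro mult_mono True L(2)) auto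
      also have "1 * (L * norm x) \<le> c / 2 * norm x" using mult_right_mono[OF c(3), of "norm x"] by simp
      finally have "1 * norm x \<le> 2 * norm (U z - w *\<^sub>C z)"
        using mult_right_mono[OF c(1), of "norm x"] by simp
      then have "norm x \<le> 2 * norm (U z - w *\<^sub>C z)" by simp
      have "norm (Y z) \<le> KY * (2 * c * norm x)"
        unfolding x by (rule order_trans[OF KY(2)]) (intro mult_left_mono P_le KY(1))
      also have "\<dots> \<le> KY * (2 * c * (2 * norm (U z - w *\<^sub>C z)))"
        using c by (intro mult_left_mono \<open>norm x \<le> _\<close> KY(1)) auto
      also have "\<dots> \<le> K' * norm (U z - w *\<^sub>C z)"
        using K c by (simp add: K'_def algebra_simps)
      finally show ?thesis .
    next
      case False
      then have w1: "1 - w \<noteq> 0" by auto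
      define a where "a = - (2 * c * Im w) / (cmod (1 - w))\<^sup>2"
      \<comment> \<open>The point \<open>a = \<i> c (1 + w) / (1 - w)\<close> is real because \<open>w\<close> has modulus one.\<close>
      have a: "of_real a * (1 - w) = \<i> * of_real c * (1 + w)"
      proof -
        have "w * cnj w = 1" using complex_norm_square[of w] w by simp
        then have "(1 + w) * cnj (1 - w) = w - cnj w" by (simp add: algebra_simps)
        also have "\<dots> = of_real (2 * Im w) * \<i>" by (rule complex_diff_cnj)
        finally have "(\<i> * of_real c * (1 + w)) * cnj (1 - w) = of_real (- (2 * c * Im w))"
          by (simp add: mult.assoc)
        also have "\<dots> = of_real a * of_real ((cmod (1 - w))\<^sup>2)"
          using w1 by (simp add: a_def)
        also have "\<dots> = of_real a * (1 - w) * cnj (1 - w)"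
          by (simp only: complex_norm_square mult.assoc)
        finally show ?thesis
          using w1 by (simp del: complex_cnj_diff)
      qed
      have "U z - w *\<^sub>C z = (1 - w) *\<^sub>C (A x - a *\<^sub>R x)"
        unfolding diff a[symmetric]
        by (simp add: scaleC_diff_right scaleC_of_real[symmetric] scaleC_scaleC mult.commute)
      then have "norm (A x - a *\<^sub>R x) \<le> norm (U z - w *\<^sub>C z)"
        using False by (simp add: norm_scaleC mult_le_cancel_right1)
      have "A z - a *\<^sub>R z = P (A x - a *\<^sub>R x)"
        by (simp add: x P_def linear_add[OF linA] linear_diff[OF linA] linear_cmul[OF linA]
            bounded_clinear_scaleC[OF A] scaleC_diff_right scaleR_commute_scaleC scaleR_add_right)
      then have "norm (A z - a *\<^sub>R z) \<le> 2 * c * norm (A x - a *\<^sub>R x)" by (simp add: P_le)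
      also have "\<dots> \<le> 2 * c * norm (U z - w *\<^sub>C z)"
        using c by (intro mult_left_mono \<open>norm (A x - a *\<^sub>R x) \<le> _\<close>) auto
      finally have "norm (Y z) \<le> K * (2 * c * norm (U z - w *\<^sub>C z))"
        by (intro order_trans[OF dom[of z a]] mult_left_mono K)
      also have "\<dots> \<le> K' * norm (U z - w *\<^sub>C z)"
        using KY(1) K c by (simp add: K'_def algebra_simps)
      finally show ?thesis .
    qed
  qed
  have "K' \<ge> 0" using KY(1) K c by (simp add: K'_def)
  show ?thesis
    by (rule isometry_dominated_eq_zero[OF U isoU \<open>surj U\<close> Y \<open>K' \<ge> 0\<close> domU])
qed

section \<open>Operators squeezed between tangents and quadratic errors\<close>

text \<open>The hypotheses state \<open>0 \<le> P \<le> \<gamma> (A - a)\<^sup>2\<close> for \<open>P = \<alpha> + \<beta> A - S\<close>. Since \<open>R\<close> commutes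
  with \<open>A\<close>, its commutators with \<open>S\<close> and with \<open>P\<close> agree up to sign, and \<open>\<parallel>P x\<parallel>\<close> is
  controlled by \<open>\<parallel>(A - a) x\<parallel>\<close>.\<close>

lemma commutator_le:
  fixes A S R :: "'a::complex_inner \<Rightarrow> 'a"
  assumes linA: "linear A" and symA: "\<And>x y. cinner (A x) y = cinner x (A y)"
    and L: "\<And>x. norm (A x) \<le> L * norm x"
    and linS: "linear S" and symS: "\<And>x y. cinner (S x) y = cinner x (S y)"
    and posS: "\<And>x. 0 \<le> Re (cinner (S x) x)"
    and linR: "linear R" and comm: "\<And>x. R (A x) = A (R x)" and r: "\<And>x. norm (R x) \<le> r * norm x"
    and "0 \<le> r"
    and coeff: "0 \<le> \<beta>" "0 < \<alpha> + \<beta> * L" "0 \<le> \<gamma>"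
    and lower: "\<And>x. Re (cinner (S x) x) \<le> \<alpha> * (norm x)\<^sup>2 + \<beta> * Re (cinner (A x) x)"
    and upper: "\<And>x. \<alpha> * (norm x)\<^sup>2 + \<beta> * Re (cinner (A x) x) - Re (cinner (S x) x)
                  \<le> \<gamma> * (norm (A x - a *\<^sub>R x))\<^sup>2"
  shows "norm (R (S x) - S (R x)) \<le> 2 * r * (sqrt ((\<alpha> + \<beta> * L) * \<gamma>) * norm (A x - a *\<^sub>R x))"
proof -
  define P where "P x = \<alpha> *\<^sub>R x + \<beta> *\<^sub>R A x - S x" for x
  define \<kappa> where "\<kappa> = sqrt ((\<alpha> + \<beta> * L) * \<gamma>)"
  have linP: "linear P"
    by (rule linearI) (simp_all add: P_def linear_add[OF linA] linear_add[OF linS]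
        linear_cmul[OF linA] linear_cmul[OF linS] algebra_simps)
  have symP: "cinner (P x) y = cinner x (P y)" for x y
    by (simp add: P_def cinner_simps symA symS)
  have form: "Re (cinner (P x) x) = \<alpha> * (norm x)\<^sup>2 + \<beta> * Re (cinner (A x) x) - Re (cinner (S x) x)" for x
    by (simp add: P_def cinner_simps Re_cinner_self)
  have P_le: "Re (cinner (P x) x) \<le> (\<alpha> + \<beta> * L) * (norm x)\<^sup>2" for x
  proof -
    have "Re (cinner (A x) x) \<le> norm (A x) * norm x" by (rule Re_cinner_le)
    also have "\<dots> \<le> L * norm x * norm x" by (intro mult_right_mono L) simp
    finally have "\<beta> * Re (cinner (A x) x) \<le> \<beta> * (L * norm x * norm x)"
      by (intro mult_left_mono coeff)
    then show ?thesis using posS[of x] unfolding form by (simp add: power2_eq_square algebra_simps)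
  qed
  have normP: "norm (P x) \<le> \<kappa> * norm (A x - a *\<^sub>R x)" for x
  proof -
    have "(norm (P x))\<^sup>2 \<le> (\<alpha> + \<beta> * L) * Re (cinner (P x) x)"
      by (rule positive_norm_square_le[OF linP symP _ P_le coeff(2)]) (use lower form in simp)
    also have "\<dots> \<le> (\<alpha> + \<beta> * L) * (\<gamma> * (norm (A x - a *\<^sub>R x))\<^sup>2)"
      unfolding form by (intro mult_left_mono upper less_imp_le[OF coeff(2)])
    finally have "norm (P x) \<le> sqrt ((\<alpha> + \<beta> * L) * \<gamma> * (norm (A x - a *\<^sub>R x))\<^sup>2)"
      by (intro real_le_rsqrt) (simp add: mult.assoc)
    then show ?thesis by (simp add: \<kappa>_def real_sqrt_mult)
  qed
  have "0 \<le> \<kappa>" using coeff by (simp add: \<kappa>_def)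
  have "R (S x) - S (R x) = P (R x) - R (P x)"
    by (simp add: P_def linear_add[OF linR] linear_diff[OF linR] linear_cmul[OF linR] comm)
  then have "norm (R (S x) - S (R x)) \<le> norm (P (R x)) + norm (R (P x))"
    by (simp add: norm_triangle_ineq4)
  also have "norm (P (R x)) \<le> \<kappa> * norm (A (R x) - a *\<^sub>R R x)" by (rule normP)
  also have "A (R x) - a *\<^sub>R R x = R (A x - a *\<^sub>R x)"
    by (simp add: linear_diff[OF linR] linear_cmul[OF linR] comm)
  also have "\<kappa> * norm (R (A x - a *\<^sub>R x)) \<le> \<kappa> * (r * norm (A x - a *\<^sub>R x))"
    by (intro mult_left_mono r \<open>0 \<le> \<kappa>\<close>)
  also have "norm (R (P x)) \<le> r * (\<kappa> * norm (A x - a *\<^sub>R x))"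
    by (intro order_trans[OF r] mult_left_mono normP \<open>0 \<le> r\<close>)
  finally show ?thesis by (simp add: \<kappa>_def mult_ac)
qed

text \<open>The two inequalities express in terms of quadratic forms that \<open>S\<close> behaves like the
  \<open>n\<close>-th root of \<open>A\<close>: for \<open>a = t ^ n\<close>, the tangent of the function \<open>root n s\<close> at
  \<open>s = a\<close> is \<open>(1 - 1 / n) t + t s / (n a)\<close>. Evaluated at \<open>A\<close> it dominates \<open>S\<close>, with
  an error of at most \<open>(1 - 1 / n) t (1 - A / a)\<^sup>2\<close>. Both sides are multiplied by \<open>n\<close>.\<close>

locale root_osculation =
  fixes A S :: "'a::complex_hilbert_space \<Rightarrow> 'a" and n :: nat
  assumes A: "bounded_clinear A" and symA: "\<And>x y. cinner (A x) y = cinner x (A y)"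
    and posA: "\<And>x. 0 \<le> Re (cinner (A x) x)"
    and S: "bounded_clinear S" and symS: "\<And>x y. cinner (S x) y = cinner x (S y)"
    and posS: "\<And>x. 0 \<le> Re (cinner (S x) x)"
    and n: "n \<ge> 1"
    and lower: "\<And>t x. t > 0 \<Longrightarrow> real n * Re (cinner (S x) x)
        \<le> (real n - 1) * t * (norm x)\<^sup>2 + t / t ^ n * Re (cinner (A x) x)"
    and upper: "\<And>t x. t > 0 \<Longrightarrow> (real n - 1) * t * (norm x)\<^sup>2 + t / t ^ n * Re (cinner (A x) x)
        - real n * Re (cinner (S x) x) \<le> (real n - 1) * t * (norm (x - (1 / t ^ n) *\<^sub>R A x))\<^sup>2"
begin

text \<open>The factor \<open>a\<^sup>2\<close> compensates for the growth of the constant as \<open>a\<close> tends to \<open>0\<close>,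
  where the \<open>n\<close>-th root is not differentiable if \<open>n > 1\<close>.\<close>

lemma commutator_bound_pos:
  assumes L: "L \<ge> 1" "\<And>x. norm (A x) \<le> L * norm x"
    and R: "bounded_clinear R" and comm: "\<And>x. R (A x) = A (R x)"
    and r: "r \<ge> 0" "\<And>x. norm (R x) \<le> r * norm x"
    and a: "a > 0"
  shows "a\<^sup>2 * norm (R (S x) - S (R x)) \<le> 2 * r * ((1 + a) * (a + L)) * norm (A x - a *\<^sub>R x)"
proof -
  define t where "t = root n a"
  have t: "t > 0" and tn: "t ^ n = a" using a n by (simp_all add: t_def)
  have t_le: "t \<le> 1 + a"
  proof (cases "t \<le> 1")
    case False
    then have "t ^ 1 \<le> t ^ n" using n by (intro power_increasing) auto
    then show ?thesis using tn by simp
  qed (use a in simp)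
  define \<alpha> where "\<alpha> = (1 - 1 / real n) * t"
  define \<beta> where "\<beta> = t / (real n * a)"
  define \<gamma> where "\<gamma> = (1 - 1 / real n) * t / a\<^sup>2"
  have n0: "real n \<ge> 1" using n by simp
  have coeff: "0 \<le> \<alpha>" "0 < \<beta>" "0 \<le> \<gamma>" using n0 t a by (simp_all add: \<alpha>_def \<beta>_def \<gamma>_def)
  have pos: "0 < \<alpha> + \<beta> * L" using coeff L by (simp add: add_nonneg_pos)
  have lo: "Re (cinner (S x) x) \<le> \<alpha> * (norm x)\<^sup>2 + \<beta> * Re (cinner (A x) x)" for x
    using lower[OF t, of x] n0 unfolding tn \<alpha>_def \<beta>_def by (simp add: field_simps)
  have up: "\<alpha> * (norm x)\<^sup>2 + \<beta> * Re (cinner (A x) x) - Re (cinner (S x) x)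
      \<le> \<gamma> * (norm (A x - a *\<^sub>R x))\<^sup>2" for x
  proof -
    have "x - (1 / a) *\<^sub>R A x = (- 1 / a) *\<^sub>R (A x - a *\<^sub>R x)"
      using a by (simp add: scaleR_diff_right)
    then have "(norm (x - (1 / a) *\<^sub>R A x))\<^sup>2 = (norm (A x - a *\<^sub>R x))\<^sup>2 / a\<^sup>2"
      by (simp add: power_divide power_mult_distrib)
    then have "(real n - 1) * t * (norm x)\<^sup>2 + t / a * Re (cinner (A x) x) - real n * Re (cinner (S x) x)
        \<le> (real n - 1) * t * ((norm (A x - a *\<^sub>R x))\<^sup>2 / a\<^sup>2)"
      using upper[OF t, of x] unfolding tn by simp
    then have "((real n - 1) * t * (norm x)\<^sup>2 + t / a * Re (cinner (A x) x) - real n * Re (cinner (S x) x)) / real n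
        \<le> ((real n - 1) * t * ((norm (A x - a *\<^sub>R x))\<^sup>2 / a\<^sup>2)) / real n"
      by (rule divide_right_mono) simp
    moreover have "((real n - 1) * t * u + t / a * v - real n * w) / real n = \<alpha> * u + \<beta> * v - w" for u v w
      using n0 a by (simp add: \<alpha>_def \<beta>_def field_simps)
    moreover have "((real n - 1) * t * (u / a\<^sup>2)) / real n = \<gamma> * u" for u
      using n0 a by (simp add: \<gamma>_def field_simps)
    ultimately show ?thesis by simp
  qed
  have "norm (R (S x) - S (R x)) \<le> 2 * r * (sqrt ((\<alpha> + \<beta> * L) * \<gamma>) * norm (A x - a *\<^sub>R x))"
    by (rule commutator_le[OF bounded_clinear_linear[OF A] symA L(2) bounded_clinear_linear[OF S]
          symS posS bounded_clinear_linear[OF R] comm r(2) r(1) less_imp_le[OF coeff(2)] pos coeff(3) lo up])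
  then have "a\<^sup>2 * norm (R (S x) - S (R x))
      \<le> a\<^sup>2 * (2 * r * (sqrt ((\<alpha> + \<beta> * L) * \<gamma>) * norm (A x - a *\<^sub>R x)))"
    by (intro mult_left_mono) auto
  also have "\<dots> = 2 * r * (a\<^sup>2 * sqrt ((\<alpha> + \<beta> * L) * \<gamma>)) * norm (A x - a *\<^sub>R x)"
    by (simp add: mult_ac)
  also have "\<dots> \<le> 2 * r * ((1 + a) * (a + L)) * norm (A x - a *\<^sub>R x)"
  proof (intro mult_right_mono mult_left_mono)
    have "\<alpha> \<le> t" using n0 t by (simp add: \<alpha>_def field_simps)
    moreover have "\<beta> \<le> t / a" using n0 t a by (simp add: \<beta>_def field_simps)
    ultimately have "\<alpha> + \<beta> * L \<le> t + t / a * L"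
      using L by (intro add_mono mult_right_mono) auto
    moreover have "\<gamma> \<le> t / a\<^sup>2" using n0 t a by (simp add: \<gamma>_def divide_simps)
    ultimately have "(\<alpha> + \<beta> * L) * \<gamma> \<le> (t + t / a * L) * (t / a\<^sup>2)"
      using coeff t a L by (intro mult_mono) auto
    also have "\<dots> = t\<^sup>2 * (a * (a + L)) / (a\<^sup>2)\<^sup>2"
      using a by (simp add: field_simps power2_eq_square)
    also have "\<dots> \<le> (1 + a)\<^sup>2 * ((a + L) * (a + L)) / (a\<^sup>2)\<^sup>2"
      using t t_le a L by (intro divide_right_mono mult_mono power_mono) auto
    also have "\<dots> = ((1 + a) * (a + L) / a\<^sup>2)\<^sup>2"
      by (simp add: power_mult_distrib power_divide power2_eq_square)
    finally have "sqrt ((\<alpha> + \<beta> * L) * \<gamma>) \<le> (1 + a) * (a + L) / a\<^sup>2"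
      using a L by (intro real_le_lsqrt) (auto simp: coeff intro!: mult_nonneg_nonneg add_nonneg_nonneg less_imp_le[OF pos])
    then show "a\<^sup>2 * sqrt ((\<alpha> + \<beta> * L) * \<gamma>) \<le> (1 + a) * (a + L)"
      using a by (simp add: field_simps)
  qed (use r in auto)
  finally show ?thesis .
qed

text \<open>With \<open>Y = R S - S R\<close>, this says \<open>Y A\<^sup>2 = 0\<close>.\<close>

lemma commutator_square_eq_zero:
  assumes R: "bounded_clinear R" and comm: "\<And>x. R (A x) = A (R x)"
  shows "R (S (A (A x))) = S (R (A (A x)))"
proof -
  obtain L0 where L0: "L0 \<ge> 0" "\<And>x. norm (A x) \<le> L0 * norm x"
    using bounded_clinear_bound[OF A] by blast
  define L where "L = L0 + 1"
  have L: "L \<ge> 1" "norm (A x) \<le> L * norm x" for x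
    using L0(1) order_trans[OF L0(2)[of x], of "L * norm x"] by (auto simp: L_def mult_right_mono)
  obtain r where r: "r \<ge> 0" "\<And>x. norm (R x) \<le> r * norm x"
    using bounded_clinear_bound[OF R] by blast
  note linA = bounded_clinear_linear[OF A]
  define Y where "Y x = R (S x) - S (R x)" for x
  have Y: "bounded_clinear Y"
    unfolding Y_def
    by (rule bounded_clinear_diff[OF bounded_clinear_compose[OF R S] bounded_clinear_compose[OF S R]])
  obtain KY where KY: "KY \<ge> 0" "\<And>x. norm (Y x) \<le> KY * norm x"
    using bounded_clinear_bound[OF Y] by blast
  define B where "B = KY * (2 * L + 1) + 2 * r * ((2 + L) * (2 * L + 1))"
  define K where "K = KY * L * L + B"
  have "0 \<le> KY * L" "0 \<le> B"
    using KY(1) L(1) r(1) by (simp_all add: B_def)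
  moreover have "KY * L \<le> KY * L * L"
    using mult_left_mono[OF L(1) \<open>0 \<le> KY * L\<close>] by simp
  ultimately have K: "KY * L \<le> K" "KY * L * L \<le> K" "0 \<le> K" "B \<le> K"
    unfolding K_def by linarith+
  have YAA: "norm (Y (A (A x))) \<le> KY * L * norm (A x)" for x
    by (rule order_trans[OF KY(2)]) (use KY(1) L(2) in \<open>simp add: mult.assoc mult_left_mono\<close>)
  have dom: "norm (Y (A (A x))) \<le> K * norm (A x - a *\<^sub>R x)" for a x
  proof -
    consider "a \<le> 0" | "a \<ge> L + 1" | "0 < a" "a \<le> L + 1" by linarith
    then show ?thesis
    proof cases
      case 1
      have "0 \<le> (- 2 * a) * Re (cinner (A x) x)" using 1 posA[of x] by (simp add: mult_nonpos_nonneg)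
      moreover have re: "Re (cinner (A x) (a *\<^sub>R x)) = a * Re (cinner (A x) x)"
        by (simp add: cinner_scaleR_right)
      ultimately have "(norm (A x))\<^sup>2 \<le> (norm (A x - a *\<^sub>R x))\<^sup>2"
        using zero_le_power2[of "norm (a *\<^sub>R x)"] re
        unfolding norm_diff_square by linarith
      then have "norm (A x) \<le> norm (A x - a *\<^sub>R x)"
        by (rule power2_le_imp_le) simp
      then show ?thesis
        using YAA[of x] K KY(1) L(1) by (meson mult_mono norm_ge_zero order_trans)
    next
      case 2
      have "a * norm x \<le> norm (A x - a *\<^sub>R x) + norm (A x)"
        using norm_triangle_sub[of "a *\<^sub>R x" "A x"] 2 L(1) by (simp add: norm_minus_commute add.commute)
      moreover have "(L + 1) * norm x \<le> a * norm x" using 2 by (intro mult_right_mono) auto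
      ultimately have "norm x \<le> norm (A x - a *\<^sub>R x)"
        using L(2)[of x] by (simp add: algebra_simps)
      moreover have "norm (Y (A (A x))) \<le> KY * L * L * norm x"
        using YAA[of x] mult_left_mono[OF L(2)[of x], of "KY * L"] KY(1) L(1) by (simp add: mult.assoc)
      ultimately show ?thesis
        using K by (meson mult_mono norm_ge_zero order_trans)
    next
      case 3
      \<comment> \<open>\<open>A\<^sup>2 = (A + a) (A - a) + a\<^sup>2\<close>, where the last summand is covered by the bound for
        \<open>a\<^sup>2 Y\<close>.\<close>
      have split: "A (A x) = A (A x - a *\<^sub>R x) + a *\<^sub>R (A x - a *\<^sub>R x) + a\<^sup>2 *\<^sub>R x"
        by (simp add: linear_diff[OF linA] linear_cmul[OF linA] scaleR_diff_right power2_eq_square)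
      have lin: "Y (u + v) = Y u + Y v" "Y (b *\<^sub>R u) = b *\<^sub>R Y u" for u v b
        using linear_add[OF bounded_clinear_linear[OF Y]] linear_cmul[OF bounded_clinear_linear[OF Y]] by auto
      define d where "d = A x - a *\<^sub>R x"
      have "norm (A d + a *\<^sub>R d) \<le> (2 * L + 1) * norm d"
      proof -
        have "norm (A d + a *\<^sub>R d) \<le> L * norm d + a * norm d"
          using norm_triangle_ineq[of "A d" "a *\<^sub>R d"] L(2)[of d] 3 by simp
        also have "\<dots> \<le> L * norm d + (L + 1) * norm d" using 3 by (intro add_left_mono mult_right_mono) auto
        finally show ?thesis by (simp add: algebra_simps)
      qed
      then have 1: "norm (Y (A d + a *\<^sub>R d)) \<le> KY * (2 * L + 1) * norm d"
        using KY(1) by (intro order_trans[OF KY(2)]) (simp add: mult.assoc mult_left_mono)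
      have "a\<^sup>2 * norm (Y x) \<le> 2 * r * ((1 + a) * (a + L)) * norm d"
        unfolding Y_def d_def by (rule commutator_bound_pos[OF L R comm r 3(1)])
      also have "\<dots> \<le> 2 * r * ((2 + L) * (2 * L + 1)) * norm d"
        using r L(1) 3 by (intro mult_right_mono mult_left_mono mult_mono) auto
      finally have 2: "norm (Y (a\<^sup>2 *\<^sub>R x)) \<le> 2 * r * ((2 + L) * (2 * L + 1)) * norm d"
        by (simp add: lin)
      have "norm (Y (A (A x))) \<le> norm (Y (A d + a *\<^sub>R d)) + norm (Y (a\<^sup>2 *\<^sub>R x))"
        using norm_triangle_ineq[of "Y (A d + a *\<^sub>R d)" "Y (a\<^sup>2 *\<^sub>R x)"]
        by (simp add: split[folded d_def] lin(1)[of "A d + a *\<^sub>R d"])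
      also have "\<dots> \<le> B * norm d"
        using 1 2 by (simp add: B_def distrib_right)
      also have "\<dots> \<le> K * norm d" by (intro mult_right_mono K) simp
      finally show ?thesis by (simp add: d_def)
    qed
  qed
  have "Y (A (A x)) = 0"
    by (rule dominated_by_translates_eq_zero[OF A symA _ K(3) dom])
       (rule bounded_clinear_compose[OF Y bounded_clinear_compose[OF A A]])
  then show ?thesis by (simp add: Y_def)
qed

lemma kernel_subset:
  assumes "A x = 0"
  shows "S x = 0"
proof -
  obtain K where K: "K \<ge> 0" "\<And>x. norm (S x) \<le> K * norm x"
    using bounded_clinear_bound[OF S] by blast
  have le: "Re (cinner (S y) y) \<le> (K + 1) * (norm y)\<^sup>2" for y
  proof -
    have "Re (cinner (S y) y) \<le> norm (S y) * norm y" by (rule Re_cinner_le)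
    also have "\<dots> \<le> (K + 1) * norm y * norm y"
      by (intro mult_right_mono order_trans[OF K(2)]) auto
    finally show ?thesis by (simp add: power2_eq_square mult.assoc)
  qed
  have "Re (cinner (S x) x) \<le> 0 + e" if "e > 0" for e
  proof -
    define s where "s = e / (1 + (norm x)\<^sup>2)"
    have s: "s > 0" using that by (simp add: s_def add_pos_nonneg)
    have "real n * Re (cinner (S x) x) \<le> (real n - 1) * (s * (norm x)\<^sup>2)"
      using lower[OF s, of x] assms by (simp add: mult.assoc)
    also have "\<dots> \<le> real n * (s * (norm x)\<^sup>2)" using s by (intro mult_right_mono) auto
    finally have "Re (cinner (S x) x) \<le> s * (norm x)\<^sup>2" using n by simp
    also have "\<dots> \<le> s * (1 + (norm x)\<^sup>2)" using s by simp
    also have "\<dots> = e" by (simp add: s_def add_nonneg_eq_0_iff)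
    finally show ?thesis by simp
  qed
  then have "Re (cinner (S x) x) \<le> 0" by (rule field_le_epsilon)
  moreover have "(norm (S x))\<^sup>2 \<le> (K + 1) * Re (cinner (S x) x)"
    by (rule positive_norm_square_le[OF bounded_clinear_linear[OF S] symS posS le]) (use K in simp)
  ultimately have "(norm (S x))\<^sup>2 \<le> 0"
    using posS[of x] by simp
  then show ?thesis by simp
qed

lemma commutes:
  assumes R: "bounded_clinear R" and R': "bounded_clinear R'"
    and adj: "\<And>x y. cinner (R x) y = cinner x (R' y)"
    and comm: "\<And>x. R (A x) = A (R x)"
  shows "R (S x) = S (R x)"
proof -
  have comm': "R' (A x) = A (R' x)" for x
    by (rule cinner_eqI) (simp add: adj[symmetric] symA[symmetric] comm)
  define y where "y = R (S x) - S (R x)"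
  \<comment> \<open>Since \<open>R'\<close> also commutes with \<open>A\<close>, its commutator with \<open>S\<close> annihilates the range of
    \<open>A\<^sup>2\<close>; taking adjoints puts the range of \<open>R S - S R\<close> into the kernel of \<open>A\<^sup>2\<close>.\<close>
  have "cinner (A (A y)) z = 0" for z
  proof -
    have "cinner (A (A y)) z = cinner x (S (R' (A (A z)))) - cinner x (R' (S (A (A z))))"
      by (simp add: y_def symA adj symS cinner_diff_left)
    then show ?thesis by (simp add: commutator_square_eq_zero[OF R' comm'])
  qed
  from this[of y] have "cinner (A y) (A y) = 0" by (simp add: symA)
  then have Ay: "A y = 0" by (simp add: cinner_self)
  then have "A (R' y) = 0"
    using comm'[of y] linear_0[OF bounded_clinear_linear[OF R']] by simp
  have "cinner y y = cinner x (S (R' y)) - cinner (R x) (S y)"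
    by (subst (1) y_def) (simp add: cinner_diff_left adj symS)
  also have "\<dots> = 0"
    using kernel_subset[OF Ay] kernel_subset[OF \<open>A (R' y) = 0\<close>] by simp
  finally show ?thesis by (simp add: cinner_self y_def)
qed

end

section \<open>Paranormal roots of quasinormal operators\<close>

lemma sequentially_convex_bounds:
  fixes c :: "nat \<Rightarrow> real"
  assumes conv: "\<And>k. 2 * c (Suc k) \<le> c k + c (Suc (Suc k))" and n: "n \<ge> 1"
  shows "real n * c 1 \<le> (real n - 1) * c 0 + c n"
    and "(2 * real n - 1) * c n \<le> real n * c 1 + (real n - 1) * c (2 * n)"
proof -
  define d where "d k = c (Suc k) - c k" for k
  have "incseq d"
    by (rule incseq_SucI) (use conv in \<open>simp add: d_def algebra_simps\<close>)
  then have mono: "d j \<le> d k" if "j \<le> k" for j k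
    using that by (simp add: incseq_def)
  have tel: "c b - c a = (\<Sum>k=a..<b. d k)" if "a \<le> b" for a b
    using that by (simp add: d_def sum_Suc_diff')
  have "real n * d 0 = (\<Sum>k=0..<n. d 0)" by simp
  also have "\<dots> \<le> (\<Sum>k=0..<n. d k)" by (intro sum_mono mono) simp
  also have "\<dots> = c n - c 0" by (simp add: tel)
  finally show "real n * c 1 \<le> (real n - 1) * c 0 + c n"
    by (simp add: d_def algebra_simps)
  have "c n - c 1 = (\<Sum>k=1..<n. d k)" using n by (rule tel)
  also have "\<dots> \<le> (\<Sum>k=1..<n. d n)" by (intro sum_mono mono) simp
  also have "\<dots> = (real n - 1) * d n" using n by (simp add: of_nat_diff)
  finally have 1: "real n * (c n - c 1) \<le> real n * ((real n - 1) * d n)"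
    by (rule mult_left_mono) simp
  have "real n * d n = (\<Sum>k=n..<2*n. d n)" by simp
  also have "\<dots> \<le> (\<Sum>k=n..<2*n. d k)" by (intro sum_mono mono) simp
  also have "\<dots> = c (2 * n) - c n" by (simp add: tel)
  finally have 2: "(real n - 1) * (real n * d n) \<le> (real n - 1) * (c (2 * n) - c n)"
    using n by (intro mult_left_mono) auto
  show "(2 * real n - 1) * c n \<le> real n * c 1 + (real n - 1) * c (2 * n)"
    using 1 2 by (simp add: algebra_simps)
qed

text \<open>The arithmetic-geometric mean inequality turns logarithmic convexity into convexity after
  any rescaling by \<open>t\<close>.\<close>

lemma paranormal_convex:
  assumes "paranormal T" and t: "t > 0"
  shows "2 * ((norm ((T ^^ Suc k) x))\<^sup>2 / t ^ Suc k)
    \<le> (norm ((T ^^ k) x))\<^sup>2 / t ^ k + (norm ((T ^^ Suc (Suc k)) x))\<^sup>2 / t ^ Suc (Suc k)"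
proof -
  define p q s where pqs: "p = norm ((T ^^ k) x)" "q = norm ((T ^^ Suc k) x)"
    and pqs': "s = norm ((T ^^ Suc (Suc k)) x)"
  have "q\<^sup>2 \<le> s * p"
    using assms(1)[unfolded paranormal_def, rule_format, of "(T ^^ k) x"]
    by (simp add: pqs pqs' numeral_2_eq_2)
  moreover have "0 \<le> (p * t - s)\<^sup>2" by simp
  moreover have "2 * t * q\<^sup>2 \<le> 2 * t * (s * p)"
    using \<open>q\<^sup>2 \<le> s * p\<close> t by (intro mult_left_mono) auto
  ultimately have "2 * t * q\<^sup>2 \<le> t\<^sup>2 * p\<^sup>2 + s\<^sup>2"
    by (simp add: power2_diff power_mult_distrib mult_ac)
  then have "2 * t * q\<^sup>2 / t ^ Suc (Suc k) \<le> (t\<^sup>2 * p\<^sup>2 + s\<^sup>2) / t ^ Suc (Suc k)"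
    using t by (intro divide_right_mono) auto
  then show ?thesis
    unfolding pqs[symmetric] pqs'[symmetric] using t by (simp add: add_divide_distrib power2_eq_square)
qed

theorem theorem4p12:
  fixes T :: "'a::complex_hilbert_space \<Rightarrow> 'a" and n :: nat
  assumes "bounded_clinear T"
    and "paranormal T"
    and "n \<ge> 1"
    and "quasinormal (T ^^ n)"
  shows "quasinormal T"
proof -
  obtain T' where T': "bounded_clinear T'" and adjT: "\<And>x y. cinner (T x) y = cinner x (T' y)"
    using adjoint_exists[OF assms(1)] by blast
  define Q where "Q = T ^^ n"
  define Q' where "Q' = T' ^^ n"
  define A where "A x = Q' (Q x)" for x
  define S where "S x = T' (T x)" for x
  have Q: "bounded_clinear Q" and Q': "bounded_clinear Q'"
    unfolding Q_def Q'_def by (intro bounded_clinear_funpow assms(1) T')+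
  have adjQ: "cinner (Q x) y = cinner x (Q' y)" for x y
    unfolding Q_def Q'_def by (rule adjoint_funpow[OF adjT])
  note adjT' = adjoint_swap[of T T', OF adjT] and adjQ' = adjoint_swap[of Q Q', OF adjQ]
  have "cadjoint Q = Q'" by (rule cadjoint_eqI[OF adjQ])
  then have QA: "Q (A x) = A (Q x)" for x
    using assms(4) unfolding quasinormal_def Q_def[symmetric] A_def
    by (metis comp_apply)
  have TQ: "T (Q x) = Q (T x)" for x
    unfolding Q_def by (metis funpow_swap1)
  have A: "bounded_clinear A" and S: "bounded_clinear S"
    unfolding A_def S_def
    by (rule bounded_clinear_compose[OF Q' Q], rule bounded_clinear_compose[OF T' assms(1)])
  have symA: "cinner (A x) y = cinner x (A y)" and symS: "cinner (S x) y = cinner x (S y)" for x y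
    by (simp_all add: A_def S_def adjQ adjT adjQ' adjT')
  have QQ': "Q' (Q' (Q (Q x))) = A (A x)" for x
    using QA[of x] by (simp add: A_def)
  have formA: "Re (cinner (A x) x) = (norm (Q x))\<^sup>2" and formS: "Re (cinner (S x) x) = (norm (T x))\<^sup>2"
    and formAA: "(norm (A x))\<^sup>2 = (norm (Q (Q x)))\<^sup>2" for x
    by (simp_all add: A_def S_def adjQ' adjT' Re_cinner_self[symmetric])
       (metis A_def QA adjQ adjQ')
  interpret root_osculation A S n
  proof
    show "bounded_clinear A" "bounded_clinear S" "n \<ge> 1" by (fact A S assms(3))+
    show "cinner (A x) y = cinner x (A y)" "cinner (S x) y = cinner x (S y)" for x y
      by (fact symA symS)+
    show "0 \<le> Re (cinner (A x) x)" "0 \<le> Re (cinner (S x) x)" for x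
      by (simp_all add: formA formS)
    fix t :: real and x assume t: "t > 0"
    define c where "c k = (norm ((T ^^ k) x))\<^sup>2 / t ^ k" for k
    have conv: "2 * c (Suc k) \<le> c k + c (Suc (Suc k))" for k
      unfolding c_def by (rule paranormal_convex[OF assms(2) t])
    note bounds = sequentially_convex_bounds[of c n, OF conv assms(3)]
    have "c (2 * n) = (norm (Q (Q x)))\<^sup>2 / (t ^ n)\<^sup>2"
      by (simp add: c_def Q_def mult_2 funpow_add power_add power2_eq_square)
    then have c: "c 0 = (norm x)\<^sup>2" "c 1 = Re (cinner (S x) x) / t"
      "c n = Re (cinner (A x) x) / t ^ n" "c (2 * n) = (norm (A x))\<^sup>2 / (t ^ n)\<^sup>2"
      by (simp_all add: c_def formA formS formAA Q_def)
    have S_c: "Re (cinner (S x) x) = t * c 1" using t unfolding c by simp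
    have A_c: "t / t ^ n * Re (cinner (A x) x) = t * c n" by (simp add: c)
    show "real n * Re (cinner (S x) x)
        \<le> (real n - 1) * t * (norm x)\<^sup>2 + t / t ^ n * Re (cinner (A x) x)"
      unfolding S_c A_c c(1)[symmetric]
      using mult_left_mono[OF bounds(1), of t] t by (simp add: algebra_simps)
    have dist: "(norm (x - (1 / t ^ n) *\<^sub>R A x))\<^sup>2 = c 0 - 2 * c n + c (2 * n)"
      by (simp add: norm_diff_square cinner_scaleR_right Re_cinner_commute[of x] c power_divide
          power_mult_distrib)
    show "(real n - 1) * t * (norm x)\<^sup>2 + t / t ^ n * Re (cinner (A x) x)
        - real n * Re (cinner (S x) x) \<le> (real n - 1) * t * (norm (x - (1 / t ^ n) *\<^sub>R A x))\<^sup>2"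
      unfolding S_c A_c dist c(1)[symmetric]
      using mult_left_mono[OF bounds(2), of t] t by (simp add: algebra_simps)
  qed
  have SA: "A (S x) = S (A x)" for x
    by (rule commutes[OF A A symA]) simp
  have SQ: "Q (S x) = S (Q x)" for x
    by (rule commutes[OF Q Q' adjQ QA])
  have TA: "T (A x) = A (T x)" for x
  proof -
    \<comment> \<open>All three terms in the expansion of \<open>\<parallel>A T x - T A x\<parallel>\<^sup>2\<close> reduce to \<open>\<langle>S x, A\<^sup>2 x\<rangle>\<close>.\<close>
    have "(norm (A (T x)))\<^sup>2 = (norm (T (Q (Q x))))\<^sup>2"
      by (simp add: formAA TQ)
    also have "\<dots> = Re (cinner (Q (Q (S x))) (Q (Q x)))"
      by (simp add: formS[symmetric] SQ)
    also have "\<dots> = Re (cinner (S x) (A (A x)))"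
      by (simp add: adjQ QQ')
    finally have 1: "(norm (A (T x)))\<^sup>2 = Re (cinner (S x) (A (A x)))" .
    have "cinner (A (T x)) (T (A x)) = cinner (T (Q x)) (T (Q (A x)))"
      by (simp add: A_def[of "T x"] adjQ' TQ)
    also have "\<dots> = cinner (Q (S x)) (Q (A x))"
      by (simp add: SQ) (simp add: S_def adjT')
    also have "\<dots> = cinner (S x) (A (A x))"
      by (simp add: adjQ A_def)
    finally have 2: "cinner (A (T x)) (T (A x)) = cinner (S x) (A (A x))" .
    have "(norm (T (A x)))\<^sup>2 = Re (cinner (A (S x)) (A x))"
      by (simp add: formS[symmetric] SA)
    also have "\<dots> = Re (cinner (S x) (A (A x)))" by (simp add: symA)
    finally have 3: "(norm (T (A x)))\<^sup>2 = Re (cinner (S x) (A (A x)))" .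
    have "(norm (A (T x) - T (A x)))\<^sup>2 = 0"
      unfolding norm_diff_square 1 2 3 by simp
    then show ?thesis by simp
  qed
  have "T (S x) = S (T x)" for x
    by (rule commutes[OF assms(1) T' adjT TA])
  moreover have "cadjoint T = T'" by (rule cadjoint_eqI[OF adjT])
  ultimately show ?thesis
    by (simp add: quasinormal_def fun_eq_iff S_def)
qed

end
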